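(* Let $I:[0,1]^2\to[0,1]$ be a fuzzy implication which is right-continuous with respect to its second variable. Define $A_I:[0,1]^2\to[0,1]$ by $A_I(x,y)=\inf\{z\in[0,1]\mid I(x,z)\geq y\}$. Then for all $x,y\in[0,1]$ the set $\{z\in[0,1]\mid A_I(x,z)\leq y\}$ has a maximum and $$I(x,y)=\max\{z\in[0,1]\mid A_I(x,z)\leq y\}.$$ That is, $I=I_{A_I}$, where for a function $A:[0,1]^2\to[0,1]$ one sets $I_A(x,y)=\sup\{z\in[0,1]\mid A(x,z)\leq y\}$.
   Context: A fuzzy implication is a function $I:[0,1]^2\to[0,1]$ that is non-increasing in the first variable, non-decreasing in the second variable, and satisfies $I(0,0)=1$, $I(1,1)=1$, $I(1,0)=0$. *)

theory Defs
  imports Complex_Main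
begin

text \<open>
  Functions on the unit square are represented by functions on the reals, of which only the
  values on the unit square matter; all conditions and claims are restricted to it.
\<close>

abbreviation unit_interval :: "real set" where
  "unit_interval \<equiv> {0..1}"

definition fuzzy_implication :: "(real \<Rightarrow> real \<Rightarrow> real) \<Rightarrow> bool" where
  "fuzzy_implication I \<longleftrightarrow>
     (\<forall>x\<in>unit_interval. \<forall>y\<in>unit_interval. I x y \<in> unit_interval) \<and>
     (\<forall>y\<in>unit_interval. antimono_on unit_interval (\<lambda>x. I x y)) \<and>
     (\<forall>x\<in>unit_interval. mono_on unit_interval (\<lambda>y. I x y)) \<and>
     I 0 0 = 1 \<and> I 1 1 = 1 \<and> I 1 0 = 0"

text \<open>
  At the right end point 1 right-continuity is vacuous. For a point below 1 the filter
  \<^term>\<open>at_right\<close> only sees arguments inside the unit interval.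
\<close>

definition right_continuous_snd :: "(real \<Rightarrow> real \<Rightarrow> real) \<Rightarrow> bool" where
  "right_continuous_snd I \<longleftrightarrow>
     (\<forall>x\<in>unit_interval. \<forall>y\<in>{0..<1}. continuous (at_right y) (\<lambda>t. I x t))"

definition A_of :: "(real \<Rightarrow> real \<Rightarrow> real) \<Rightarrow> real \<Rightarrow> real \<Rightarrow> real" where
  "A_of I x y = Inf {z \<in> unit_interval. I x z \<ge> y}"

text \<open>
  On the reals \<^term>\<open>Sup\<close> is unspecified on the empty set, whereas in the unit interval the
  supremum of the empty set is 0. For a general function \<open>A\<close> the set below may be empty, so the
  supremum is taken in the unit interval by inserting its least element 0.
\<close>

definition I_of :: "(real \<Rightarrow> real \<Rightarrow> real) \<Rightarrow> real \<Rightarrow> real \<Rightarrow> real" where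
  "I_of A x y = Sup (insert 0 {z \<in> unit_interval. A x z \<le> y})"

definition is_maximum :: "real set \<Rightarrow> real \<Rightarrow> bool" where
  "is_maximum S m \<longleftrightarrow> m \<in> S \<and> (\<forall>z\<in>S. z \<le> m)"

text \<open>
  The set in the definition of \<^const>\<open>A_of\<close> is never empty for a fuzzy implication, so its
  infimum on the reals is the infimum in the unit interval.
\<close>

lemma fuzzy_implication_top:
  assumes "fuzzy_implication I" "x \<in> unit_interval"
  shows "I x 1 = 1"
proof -
  have "antimono_on unit_interval (\<lambda>x. I x 1)"
    using assms by (simp add: fuzzy_implication_def)
  then have "I 1 1 \<le> I x 1"
    using assms(2) by (auto dest: monotone_onD[where x = x and y = 1])
  moreover have "I 1 1 = 1" "I x 1 \<in> unit_interval"
    using assms by (auto simp: fuzzy_implication_def)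
  ultimately show ?thesis by simp
qed

lemma A_of_set_nonempty:
  assumes "fuzzy_implication I" "x \<in> unit_interval" "y \<in> unit_interval"
  shows "{z \<in> unit_interval. I x z \<ge> y} \<noteq> {}"
  using fuzzy_implication_top[OF assms(1,2)] assms(3)
  by (auto intro!: exI[of _ 1])

lemma A_of_in_unit_interval:
  assumes "fuzzy_implication I" "x \<in> unit_interval" "y \<in> unit_interval"
  shows "A_of I x y \<in> unit_interval"
proof -
  let ?S = "{z \<in> unit_interval. I x z \<ge> y}"
  have one: "1 \<in> ?S"
    using fuzzy_implication_top[OF assms(1,2)] assms(3) by auto
  have "Inf ?S \<le> 1"
    by (rule cInf_lower[OF one]) (auto intro: bdd_belowI[of _ 0])
  moreover have "0 \<le> Inf ?S"
    using one by (intro cInf_greatest) auto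
  ultimately show ?thesis by (simp add: A_of_def)
qed

end

theory Submission imports Defs begin

text \<open>
  Right-continuity makes the infimum \<open>A_of I x z\<close> attained, so that \<open>A_of I x\<close> is the lower
  adjoint of \<open>I x\<close>: \<open>A_of I x z \<le> y\<close> iff \<open>z \<le> I x y\<close>. The set in question is therefore the
  interval \<open>{0..I x y}\<close>.
\<close>

lemma A_of_le_iff:
  assumes I: "fuzzy_implication I" and rc: "right_continuous_snd I"
    and x: "x \<in> unit_interval" and y: "y \<in> unit_interval" and z: "z \<in> unit_interval"
  shows "A_of I x z \<le> y \<longleftrightarrow> z \<le> I x y"
proof
  assume "z \<le> I x y"
  then show "A_of I x z \<le> y"
    unfolding A_of_def using y by (intro cInf_lower) (auto intro: bdd_belowI[of _ 0])
next
  assume le: "A_of I x z \<le> y"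
  show "z \<le> I x y"
  proof (rule ccontr)
    assume "\<not> z \<le> I x y"
    then have less: "I x y < z" by simp
    \<comment> \<open>Right-continuity is only assumed below 1; at 1 the value
      \<open>I x 1 = 1\<close> already dominates \<open>z\<close>.\<close>
    then have "y \<noteq> 1"
      using fuzzy_implication_top[OF I x] z by auto
    then have "((\<lambda>t. I x t) \<longlongrightarrow> I x y) (at_right y)"
      using rc x y by (auto simp: right_continuous_snd_def continuous_within)
    then have "eventually (\<lambda>t. I x t < z) (at_right y)"
      using less by (rule order_tendstoD(2))
    then obtain b where b: "b > y" "\<And>t. y < t \<Longrightarrow> t < b \<Longrightarrow> I x t < z"
      by (auto simp: eventually_at_right_field)
    have mono: "mono_on unit_interval (\<lambda>t. I x t)"
      using I x by (simp add: fuzzy_implication_def)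
    \<comment> \<open>The strict inequality at \<open>y\<close> persists on the right up to
      \<open>b\<close>, and monotonicity carries it to all points left of \<open>y\<close>. So every
      point where \<open>I x\<close> reaches \<open>z\<close> is at least \<open>b\<close>, which
      pushes the infimum strictly above \<open>y\<close>.\<close>
    have "b \<le> w" if w: "w \<in> unit_interval" "z \<le> I x w" for w
    proof -
      have "y < w"
        using mono_onD[OF mono w(1) y] w(2) less by linarith
      then show ?thesis
        using b(2)[of w] w(2) by linarith
    qed
    then have "b \<le> A_of I x z"
      unfolding A_of_def using A_of_set_nonempty[OF I x z] by (intro cInf_greatest) auto
    with le b(1) show False by simp
  qed
qed

theorem theorem3p4:
  fixes I :: "real \<Rightarrow> real \<Rightarrow> real"
  assumes "fuzzy_implication I"
    and "right_continuous_snd I"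
  shows "\<forall>x\<in>unit_interval. \<forall>y\<in>unit_interval.
           is_maximum {z \<in> unit_interval. A_of I x z \<le> y} (I x y) \<and>
           I x y = I_of (A_of I) x y"
proof (intro ballI)
  fix x y :: real
  assume xy: "x \<in> unit_interval" "y \<in> unit_interval"
  have I_xy: "I x y \<in> unit_interval"
    using assms(1) xy by (simp add: fuzzy_implication_def)
  have "{z \<in> unit_interval. A_of I x z \<le> y} = {z \<in> unit_interval. z \<le> I x y}"
    using A_of_le_iff[OF assms xy] by blast
  also have "\<dots> = {0..I x y}"
    using I_xy by auto
  finally have eq: "{z \<in> unit_interval. A_of I x z \<le> y} = {0..I x y}" .
  \<comment> \<open>The 0 adjoined in \<open>I_of\<close> already lies in the interval because
    \<open>I x y\<close> is nonnegative, so the supremum is its right end point.\<close>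
  have "insert 0 {0..I x y} = {0..I x y}"
    using I_xy by auto
  then show "is_maximum {z \<in> unit_interval. A_of I x z \<le> y} (I x y) \<and> I x y = I_of (A_of I) x y"
    using I_xy unfolding is_maximum_def I_of_def eq by simp
qed

end
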